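(* Let $f$ be a graph parameter that is connected and hereditary. Then $\chi^{\ell}_{f,p}(G)\le \mathrm{col}_{f,p}(G)$ for every graph $G$ and every integer $p$.
   Context: Graphs are finite and simple. A graph parameter $f$ assigns to every graph an element of $\mathbb{N}\cup\{\infty\}$ (where $\mathbb{N}$ is the set of non-negative integers), isomorphic graphs receiving the same value. The parameter $f$ is hereditary if $f(H)\le f(G)$ whenever $H$ is an induced subgraph of $G$; it is connected if $f(G)=\max(f(G_1),f(G_2))$ whenever $G$ is the disjoint union of graphs $G_1$ and $G_2$. A list assignment $L$ for $G$ assigns to each vertex a set of colors; it is an $s$-list assignment if $|L(v)|\ge s$ for each $v\in V(G)$. An $L$-coloring is a map $\varphi$ on $V(G)$ with $\varphi(v)\in L(v)$ for every $v$ (adjacent vertices may receive the same color). For an integer $p$, a coloring $\varphi$ of $G$ is $(f,p)$-proper if $f(G[\varphi^{-1}(c)])\le p$ for each color $c$ used by $\varphi$. $\chi^{\ell}_{f,p}(G)$ is the least non-negative integer $s$ such that $G$ has an $(f,p)$-proper $L$-coloring for every $s$-list assignment $L$ of $G$ (and $\infty$ if no such $s$ exists). For a positive integer $s$, an $s$-island in a graph $G$ is a non-empty set $I\subseteq V(G)$ such that each vertex in $I$ has less than $s$ neighbors in $G$ not belonging to $I$. $\mathrm{col}_{f,p}(G)$ is the least positive integer $s$ such that every non-null induced subgraph $H$ of $G$ contains an $s$-island $I$ (of $H$) satisfying $f(H[I])\le p$ (and $\infty$ if no such $s$ exists). *)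

theory Defs
  imports
    "Graph_Theory.Digraph_Isomorphism"
    "HOL-Library.Extended_Real"
begin

text \<open>
  Finite simple graphs are the symmetric, loop-free digraphs without parallel arcs of
  \<^locale>\<open>graph\<close>; the null graph is included. Vertex and arc types are arbitrary, so a parameter
  is given by its values on the graphs over these types. If the types are infinite, every finite
  simple graph has an isomorphic copy among them.
\<close>

definition graph_parameter :: "(('a, 'b) pre_digraph \<Rightarrow> enat) \<Rightarrow> bool" where
  "graph_parameter f \<longleftrightarrow>
    (\<forall>G H. graph G \<and> graph H \<and> digraph_iso G H \<longrightarrow> f G = f H)"

definition hereditary :: "(('a, 'b) pre_digraph \<Rightarrow> enat) \<Rightarrow> bool" where
  "hereditary f \<longleftrightarrow> (\<forall>G H. graph G \<and> induced_subgraph H G \<longrightarrow> f H \<le> f G)"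

text \<open>
  The operation \<^const>\<open>union\<close> keeps the tail and head functions of its first argument, hence the
  compatibility condition. With disjoint vertex sets, the arc sets are then disjoint as well.
\<close>

definition connected_parameter :: "(('a, 'b) pre_digraph \<Rightarrow> enat) \<Rightarrow> bool" where
  "connected_parameter f \<longleftrightarrow>
    (\<forall>G\<^sub>1 G\<^sub>2. graph G\<^sub>1 \<and> graph G\<^sub>2 \<and> compatible G\<^sub>1 G\<^sub>2 \<and> verts G\<^sub>1 \<inter> verts G\<^sub>2 = {}
      \<longrightarrow> f (union G\<^sub>1 G\<^sub>2) = max (f G\<^sub>1) (f G\<^sub>2))"

text \<open>
  The bound \<open>p\<close> is an integer, possibly negative, while \<open>f\<close> takes values in \<^typ>\<open>enat\<close>; the two
  are compared as extended reals.
\<close>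

definition at_most :: "enat \<Rightarrow> int \<Rightarrow> bool" where
  "at_most x p \<longleftrightarrow> ereal_of_enat x \<le> ereal (of_int p)"

text \<open>Lists may be infinite, in which case \<^const>\<open>card\<close> would return \<open>0\<close>.\<close>

definition list_assignment :: "nat \<Rightarrow> ('a, 'b) pre_digraph \<Rightarrow> ('a \<Rightarrow> 'c set) \<Rightarrow> bool" where
  "list_assignment s G L \<longleftrightarrow> (\<forall>v \<in> verts G. infinite (L v) \<or> s \<le> card (L v))"

definition list_coloring ::
  "('a, 'b) pre_digraph \<Rightarrow> ('a \<Rightarrow> 'c set) \<Rightarrow> ('a \<Rightarrow> 'c) \<Rightarrow> bool" where
  "list_coloring G L \<phi> \<longleftrightarrow> (\<forall>v \<in> verts G. \<phi> v \<in> L v)"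

definition proper_coloring ::
  "(('a, 'b) pre_digraph \<Rightarrow> enat) \<Rightarrow> int \<Rightarrow> ('a, 'b) pre_digraph \<Rightarrow> ('a \<Rightarrow> 'c) \<Rightarrow> bool" where
  "proper_coloring f p G \<phi> \<longleftrightarrow>
    (\<forall>c \<in> \<phi> ` verts G. at_most (f (G \<restriction> {v \<in> verts G. \<phi> v = c})) p)"

text \<open>
  The infimum of the empty set in \<^typ>\<open>enat\<close> is \<open>\<infinity>\<close>; on nonempty sets it is the least element.
  The type argument is the type from which the lists draw their colors.
\<close>

definition list_chromatic ::
  "'c itself \<Rightarrow> (('a, 'b) pre_digraph \<Rightarrow> enat) \<Rightarrow> int \<Rightarrow> ('a, 'b) pre_digraph \<Rightarrow> enat" where
  "list_chromatic _ f p G =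
    Inf {enat s |s. \<forall>L :: 'a \<Rightarrow> 'c set. list_assignment s G L \<longrightarrow>
      (\<exists>\<phi>. list_coloring G L \<phi> \<and> proper_coloring f p G \<phi>)}"

definition island :: "nat \<Rightarrow> ('a, 'b) pre_digraph \<Rightarrow> 'a set \<Rightarrow> bool" where
  "island s G I \<longleftrightarrow>
    I \<noteq> {} \<and> I \<subseteq> verts G \<and> (\<forall>v \<in> I. card {u \<in> verts G - I. v \<rightarrow>\<^bsub>G\<^esub> u} < s)"

definition col :: "(('a, 'b) pre_digraph \<Rightarrow> enat) \<Rightarrow> int \<Rightarrow> ('a, 'b) pre_digraph \<Rightarrow> enat" where
  "col f p G =
    Inf {enat s |s. 0 < s \<and> (\<forall>H. induced_subgraph H G \<and> verts H \<noteq> {} \<longrightarrow>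
      (\<exists>I. island s H I \<and> at_most (f (H \<restriction> I)) p))}"

end

theory Submission
  imports Defs
begin

text \<open>
  Let \<open>s\<close> be a value for which every non-null induced subgraph of \<open>G\<close> has an \<open>s\<close>-island \<open>I\<close> with
  \<open>f(H[I]) \<le> p\<close>. Then the greedy argument that bounds the choice number by the coloring number
  works with islands in place of single vertices of small degree. Take such an island \<open>I\<close> of \<open>G\<close>
  and color \<open>G - I\<close> by induction on the number of vertices. A vertex \<open>v\<close> of \<open>I\<close> has fewer than
  \<open>s\<close> neighbors outside \<open>I\<close>, so its list contains a color that none of them carries. Choosing
  such a color for each \<open>v\<close> separately, without regard to the edges inside \<open>I\<close>, is enough: a color
  class of the resulting coloring consists of a part outside \<open>I\<close>, which was good before, and a
  part inside \<open>I\<close>, which is good because \<open>f\<close> is hereditary, and there is no edge between the two.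
  Hence \<open>f\<close> is at most \<open>p\<close> on the class because \<open>f\<close> is connected.

  The extension step is \<open>coloring_extends_over_island\<close> and the induction is
  \<open>list_coloring_from_islands\<close>. The theorem follows since every \<open>s\<close> that is admissible for
  \<^const>\<open>col\<close> is admissible for \<^const>\<open>list_chromatic\<close>.
\<close>

lemma at_most_antimono: "at_most y p \<Longrightarrow> x \<le> y \<Longrightarrow> at_most x p"
  unfolding at_most_def by (meson ereal_of_enat_le_iff order_trans)

lemma at_most_max: "at_most x p \<Longrightarrow> at_most y p \<Longrightarrow> at_most (max x y) p"
  by (simp add: max_def)

lemma induce_induce_subgraph: "Y \<subseteq> X \<Longrightarrow> (G \<restriction> X) \<restriction> Y = G \<restriction> Y"
  by (auto simp: induce_subgraph_def)

lemma induced_subgraph_trans: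
  assumes "induced_subgraph K H" "induced_subgraph H G"
  shows "induced_subgraph K G"
  using assms by (auto simp: induced_subgraph_def subgraph_def compatible_def)

lemma graph_induce_subgraph:
  assumes "graph G" "X \<subseteq> verts G"
  shows "graph (G \<restriction> X)"
proof -
  interpret graph G by fact
  have ind: "induced_subgraph (G \<restriction> X) G"
    using assms(2) by (rule induced_induce)
  show ?thesis
    using digraphI_induced[OF ind] induced_graph_imp_symmetric[OF sym_arcs ind]
    by (rule digraph.graphI)
qed

lemma hereditary_induce_mono:
  assumes "hereditary f" "graph G" "X \<subseteq> Y" "Y \<subseteq> verts G"
  shows "f (G \<restriction> X) \<le> f (G \<restriction> Y)"
proof -
  have Y: "graph (G \<restriction> Y)"
    using assms by (intro graph_induce_subgraph)
  then interpret Y: graph "G \<restriction> Y" .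
  have "induced_subgraph ((G \<restriction> Y) \<restriction> X) (G \<restriction> Y)"
    using assms(3) by (intro Y.induced_induce) simp
  then show ?thesis
    using assms(1,3) Y unfolding hereditary_def by (metis induce_induce_subgraph)
qed

lemma connected_parameter_induce_Un:
  assumes f: "connected_parameter f" and G: "graph G"
    and AB: "A \<subseteq> verts G" "B \<subseteq> verts G" "A \<inter> B = {}"
    and no_edge: "\<And>a b. a \<in> A \<Longrightarrow> b \<in> B \<Longrightarrow> \<not> b \<rightarrow>\<^bsub>G\<^esub> a"
  shows "f (G \<restriction> (A \<union> B)) = max (f (G \<restriction> A)) (f (G \<restriction> B))"
proof -
  interpret graph G by fact
  have "\<not> (tail G e \<in> A \<and> head G e \<in> B)" "\<not> (tail G e \<in> B \<and> head G e \<in> A)"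
    if "e \<in> arcs G" for e
    using that no_edge in_arcs_imp_in_arcs_ends[OF that] graph_symmetric by blast+
  then have "G \<restriction> (A \<union> B) = union (G \<restriction> A) (G \<restriction> B)"
    by (auto simp: induce_subgraph_def union_def)
  moreover have "compatible (G \<restriction> A) (G \<restriction> B)"
    by (simp add: compatible_def)
  ultimately show ?thesis
    using f AB graph_induce_subgraph[OF G] unfolding connected_parameter_def
    by (metis induce_subgraph_verts)
qed

lemma exists_unforbidden_color:
  assumes "infinite C \<or> s \<le> card C" "finite F" "card F < s"
  shows "\<exists>c \<in> C. c \<notin> F"
proof (rule ccontr)
  assume "\<not> ?thesis"
  then have "C \<subseteq> F" by blast
  then have "finite C" "card C \<le> card F"
    using assms(2) by (auto intro: finite_subset card_mono)
  then show False using assms by simp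
qed

text \<open>
  Each vertex of the island avoids the colors of its neighbors outside the island, so every color
  class is the union of an old class and a subset of the island with no edges in between.
\<close>

lemma coloring_extends_over_island:
  assumes f: "connected_parameter f" "hereditary f" and G: "graph G"
    and L: "list_assignment s G L"
    and I: "island s G I" "at_most (f (G \<restriction> I)) p"
    and \<phi>: "list_coloring (G \<restriction> (verts G - I)) L \<phi>" "proper_coloring f p (G \<restriction> (verts G - I)) \<phi>"
  shows "\<exists>\<psi>. list_coloring G L \<psi> \<and> proper_coloring f p G \<psi>"
proof -
  interpret graph G by fact
  define N where "N v = {u \<in> verts G - I. v \<rightarrow>\<^bsub>G\<^esub> u}" for v
  have IG: "I \<subseteq> verts G"
    using I(1) by (simp add: island_def)
  have "\<exists>c \<in> L v. c \<notin> \<phi> ` N v" if v: "v \<in> I" for v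
  proof (rule exists_unforbidden_color)
    show "infinite (L v) \<or> s \<le> card (L v)"
      using L v IG by (auto simp: list_assignment_def)
    have fin: "finite (N v)" unfolding N_def by simp
    then show "finite (\<phi> ` N v)" by simp
    have "card (N v) < s"
      using I(1) v by (simp add: island_def N_def)
    then show "card (\<phi> ` N v) < s"
      using card_image_le[OF fin, of \<phi>] by linarith
  qed
  then obtain g where g: "\<And>v. v \<in> I \<Longrightarrow> g v \<in> L v" "\<And>v. v \<in> I \<Longrightarrow> g v \<notin> \<phi> ` N v"
    by metis
  define \<psi> where "\<psi> v = (if v \<in> I then g v else \<phi> v)" for v
  have "list_coloring G L \<psi>"
    using \<phi>(1) g(1) by (auto simp: list_coloring_def \<psi>_def)
  moreover have "at_most (f (G \<restriction> {v \<in> verts G. \<psi> v = c})) p" for c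
  proof -
    define A where "A = {v \<in> verts G - I. \<phi> v = c}"
    define B where "B = {v \<in> I. g v = c}"
    have AB: "A \<subseteq> verts G" "B \<subseteq> verts G" "A \<inter> B = {}"
      using IG by (auto simp: A_def B_def)
    have cls: "{v \<in> verts G. \<psi> v = c} = A \<union> B"
      using IG by (auto simp: A_def B_def \<psi>_def)
    have within_island: "at_most (f (G \<restriction> X)) p" if "X \<subseteq> I" for X
      using at_most_antimono[OF I(2)] hereditary_induce_mono[OF f(2) G that IG] by blast
    have "at_most (f (G \<restriction> A)) p"
    proof (cases "A = {}")
      case True
      \<comment> \<open>A color that is new on the island is not covered by properness of \<open>\<phi>\<close>,
        but the null graph is an induced subgraph of the island.\<close>
      then show ?thesis by (simp add: within_island)
    next
      case False
      then have "c \<in> \<phi> ` (verts G - I)" by (auto simp: A_def)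
      then have "at_most (f ((G \<restriction> (verts G - I)) \<restriction> A)) p"
        using \<phi>(2) by (auto simp: proper_coloring_def A_def)
      moreover have "(G \<restriction> (verts G - I)) \<restriction> A = G \<restriction> A"
        by (rule induce_induce_subgraph) (auto simp: A_def)
      ultimately show ?thesis by simp
    qed
    moreover have "at_most (f (G \<restriction> B)) p"
      by (rule within_island) (auto simp: B_def)
    moreover have "\<not> b \<rightarrow>\<^bsub>G\<^esub> a" if "a \<in> A" "b \<in> B" for a b
      using that g(2)[of b] by (force simp: A_def B_def N_def image_iff)
    ultimately show ?thesis
      unfolding cls using connected_parameter_induce_Un[OF f(1) G AB] at_most_max by metis
  qed
  ultimately show ?thesis
    unfolding proper_coloring_def by blast
qed

lemma list_coloring_from_islands:
  assumes f: "connected_parameter f" "hereditary f" and "graph G"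
    and "list_assignment s G L"
    and "\<And>H. induced_subgraph H G \<Longrightarrow> verts H \<noteq> {} \<Longrightarrow> \<exists>I. island s H I \<and> at_most (f (H \<restriction> I)) p"
  shows "\<exists>\<phi>. list_coloring G L \<phi> \<and> proper_coloring f p G \<phi>"
  using assms(3-5)
proof (induction "card (verts G)" arbitrary: G rule: less_induct)
  case less
  interpret graph G by fact
  show ?case
  proof (cases "verts G = {}")
    case True
    then show ?thesis by (simp add: list_coloring_def proper_coloring_def)
  next
    case False
    obtain I where I: "island s G I" "at_most (f (G \<restriction> I)) p"
      using less.prems(3)[OF induced_subgraph_refl False] by blast
    let ?H = "G \<restriction> (verts G - I)"
    have H: "induced_subgraph ?H G"
      by (rule induced_induce) blast
    have "\<exists>\<phi>. list_coloring ?H L \<phi> \<and> proper_coloring f p ?H \<phi>"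
    proof (rule less.hyps)
      have "verts G - I \<subset> verts G"
        using I(1) by (auto simp: island_def)
      then show "card (verts ?H) < card (verts G)"
        by (simp add: psubset_card_mono)
      show "graph ?H"
        by (rule graph_induce_subgraph[OF less.prems(1)]) blast
      show "list_assignment s ?H L"
        using less.prems(2) by (simp add: list_assignment_def)
      show "\<exists>I. island s K I \<and> at_most (f (K \<restriction> I)) p"
        if "induced_subgraph K ?H" "verts K \<noteq> {}" for K
        using less.prems(3)[OF induced_subgraph_trans[OF that(1) H] that(2)] .
    qed
    then show ?thesis
      using coloring_extends_over_island[OF f less.prems(1,2) I] by blast
  qed
qed

theorem lemma1:
  fixes f :: "('a, 'b) pre_digraph \<Rightarrow> enat"
    and G :: "('a, 'b) pre_digraph"
    and p :: int
  assumes "graph_parameter f"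
    and "connected_parameter f"
    and "hereditary f"
    and "graph G"
  shows "list_chromatic TYPE('c) f p G \<le> col f p G"
  unfolding list_chromatic_def col_def
  by (intro Inf_superset_mono Collect_mono)
    (use list_coloring_from_islands[OF assms(2-4), where ?'c = 'c] in blast)

end
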